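(* Let $N=1$, $\Omega=(a,b)$ a bounded open interval, let $k\ge1$ be an integer and define, for all $r>0$, $$c_{k+1}(r)=\inf_{a=t_0<t_1<\dots<t_k<t_{k+1}=b}\ \max_i\{r\lambda_1(t_{2i+1}-t_{2i}),\ \lambda_1(t_{2i+2}-t_{2i+1})\},$$ where the maximum is over all $i\ge 0$ for which the indices involved lie in $\{0,\dots,k+1\}$. Then, for all $r>0$, the pair $(r^{-1}c_{k+1}(r),c_{k+1}(r))$ belongs to the Fučík spectrum $\mathcal F$.
   Context: For $\ell>0$, $\lambda_1(\ell)$ denotes the first eigenvalue of $-u''$ with Dirichlet boundary conditions on an interval of length $\ell$; so $\lambda_1(t_{j+1}-t_j)$ is the first Dirichlet eigenvalue on $(t_j,t_{j+1})$. $u^\pm:=\max\{\pm u,0\}$. The Fučík spectrum $\mathcal F$ is the set of pairs $(\lambda,\mu)\in\mathbb R^2$ such that $-u''=\lambda u^+-\mu u^-$, $u\in H^1_0(a,b)$, has a nonzero solution. *)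

theory Defs
  imports "HOL-Analysis.Analysis"
begin

text \<open>Functions on \<open>(a, b)\<close> are represented by functions on the whole real line, of which only the
  values on \<open>(a, b)\<close> matter. Elements of \<open>L\<^sup>2\<close> and Sobolev spaces are represented by Borel measurable
  functions; equality of elements is equality almost everywhere.\<close>

definition L2 :: "real \<Rightarrow> real \<Rightarrow> (real \<Rightarrow> real) set" where
  "L2 a b = {f. set_borel_measurable lborel {a<..<b} f \<and>
                set_integrable lborel {a<..<b} (\<lambda>x. (f x)\<^sup>2)}"

text \<open>The space of smooth functions with compact support in \<open>(a, b)\<close>, extended by zero.\<close>

definition test_functions :: "real \<Rightarrow> real \<Rightarrow> (real \<Rightarrow> real) set" where
  "test_functions a b = {\<phi>. (\<forall>k x. (deriv ^^ k) \<phi> field_differentiable at x) \<and>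
      (\<exists>K. compact K \<and> K \<subseteq> {a<..<b} \<and> (\<forall>x. x \<notin> K \<longrightarrow> \<phi> x = 0))}"

definition weak_derivative :: "real \<Rightarrow> real \<Rightarrow> (real \<Rightarrow> real) \<Rightarrow> (real \<Rightarrow> real) \<Rightarrow> bool" where
  "weak_derivative a b u g \<longleftrightarrow> u \<in> L2 a b \<and> g \<in> L2 a b \<and>
     (\<forall>\<phi>\<in>test_functions a b.
        (LINT x:{a<..<b}|lborel. u x * deriv \<phi> x) = - (LINT x:{a<..<b}|lborel. g x * \<phi> x))"

text \<open>\<open>H\<^sup>1\<^sub>0(a, b)\<close> is the closure of the test functions in \<open>H\<^sup>1(a, b)\<close>; the sequence below is the square
  of the \<open>H\<^sup>1\<close> distance of \<open>\<phi> n\<close> to \<open>u\<close>.\<close>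

definition H10 :: "real \<Rightarrow> real \<Rightarrow> (real \<Rightarrow> real) set" where
  "H10 a b = {u. \<exists>g. weak_derivative a b u g \<and>
     (\<exists>\<phi> :: nat \<Rightarrow> real \<Rightarrow> real. (\<forall>n. \<phi> n \<in> test_functions a b) \<and>
        (\<lambda>n. (LINT x:{a<..<b}|lborel. (\<phi> n x - u x)\<^sup>2)
              + (LINT x:{a<..<b}|lborel. (deriv (\<phi> n) x - g x)\<^sup>2)) \<longlonglongrightarrow> 0)}"

text \<open>\<open>u \<in> H\<^sup>1\<^sub>0(a, b)\<close> solves \<open>- u'' = f\<close> in \<open>(a, b)\<close> in the weak sense.\<close>

definition weak_dirichlet_solution ::
  "real \<Rightarrow> real \<Rightarrow> (real \<Rightarrow> real) \<Rightarrow> (real \<Rightarrow> real) \<Rightarrow> bool" where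
  "weak_dirichlet_solution a b f u \<longleftrightarrow> u \<in> H10 a b \<and>
     (\<exists>g. weak_derivative a b u g \<and>
        (\<forall>\<phi>\<in>test_functions a b.
           (LINT x:{a<..<b}|lborel. g x * deriv \<phi> x) = (LINT x:{a<..<b}|lborel. f x * \<phi> x)))"

definition nonzero_on :: "real \<Rightarrow> real \<Rightarrow> (real \<Rightarrow> real) \<Rightarrow> bool" where
  "nonzero_on a b u \<longleftrightarrow> \<not> (AE x in lborel. x \<in> {a<..<b} \<longrightarrow> u x = 0)"

definition dirichlet_eigenvalue :: "real \<Rightarrow> real \<Rightarrow> real \<Rightarrow> bool" where
  "dirichlet_eigenvalue a b c \<longleftrightarrow>
     (\<exists>u. weak_dirichlet_solution a b (\<lambda>x. c * u x) u \<and> nonzero_on a b u)"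

definition first_eigenvalue :: "real \<Rightarrow> real" where
  "first_eigenvalue l = (LEAST c. dirichlet_eigenvalue 0 l c)"

definition pos_part :: "(real \<Rightarrow> real) \<Rightarrow> real \<Rightarrow> real" where
  "pos_part u x = max (u x) 0"

definition neg_part :: "(real \<Rightarrow> real) \<Rightarrow> real \<Rightarrow> real" where
  "neg_part u x = max (- u x) 0"

definition fucik_spectrum :: "real \<Rightarrow> real \<Rightarrow> (real \<times> real) set" where
  "fucik_spectrum a b = {(p, q). \<exists>u.
     weak_dirichlet_solution a b (\<lambda>x. p * pos_part u x - q * neg_part u x) u \<and> nonzero_on a b u}"

text \<open>Partitions of \<open>(a, b)\<close> into \<open>m\<close> intervals. The entries \<open>t j\<close> with \<open>j > m\<close> are unconstrained and
  unused.\<close>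

definition partitions :: "real \<Rightarrow> real \<Rightarrow> nat \<Rightarrow> (nat \<Rightarrow> real) set" where
  "partitions a b m = {t. t 0 = a \<and> t m = b \<and> (\<forall>j<m. t j < t (Suc j))}"

text \<open>Each of the two families contributes exactly those of its terms whose own indices are at
  most \<open>m\<close>, so that every one of the \<open>m\<close> intervals is taken into account.\<close>

definition partition_energy :: "real \<Rightarrow> nat \<Rightarrow> (nat \<Rightarrow> real) \<Rightarrow> real" where
  "partition_energy r m t =
     Max ({r * first_eigenvalue (t (2 * i + 1) - t (2 * i)) | i. 2 * i + 1 \<le> m} \<union>
          {first_eigenvalue (t (2 * i + 2) - t (2 * i + 1)) | i. 2 * i + 2 \<le> m})"

definition optimal_energy :: "real \<Rightarrow> real \<Rightarrow> nat \<Rightarrow> real \<Rightarrow> real" where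
  "optimal_energy a b m r = (INF t\<in>partitions a b m. partition_energy r m t)"

end

theory Submission
  imports Defs
begin

text \<open>A partition with energy \<open>E\<close> has intervals of length at least \<open>\<pi> \<surd>(r/E)\<close> (even index) and
  \<open>\<pi> / \<surd>E\<close> (odd index), because \<open>\<lambda>\<^sub>1(l) = (\<pi>/l)\<^sup>2\<close>. Adding the lengths bounds \<open>E\<close> from below, and the
  bound \<open>c\<close> is attained when equality holds in each interval. On this equalizing partition, positive
  and negative sine arcs of frequencies \<open>\<surd>(c/r)\<close> and \<open>\<surd>c\<close> alternate; with slopes matched at the zeros
  they form a solution of \<open>- u'' = (c/r) u\<^sup>+ - c u\<^sup>-\<close>.\<close>

section \<open>Smooth functions flat at a point\<close>

text \<open>Most of the work lies in the formula for the first eigenvalue: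
  \<open>first_eigenvalue\<close> is a \<open>LEAST\<close> over weak eigenvalues, and
  \<open>H10\<close> is a closure of test functions. The lower bound is variational: Wirtinger's
  inequality is proved for test functions and carried to the limit, so it covers arbitrary weak
  eigenfunctions. Attaining the bound, and realising the Fucik pair, both require explicit C^1 arcs
  to be H^1 limits of compactly supported smooth functions. The derivative is therefore approximated
  first and the approximants are integrated, since in one dimension the derivative controls the
  function. The approximants rest on exp(-1/x), which is flat to infinite order at 0; the factor
  \<open>poly p (inverse x)\<close> is there because differentiation produces polynomials in
  1/x.\<close>

definition flat :: "real poly \<Rightarrow> real \<Rightarrow> real" where
  "flat p x = (if x \<le> 0 then 0 else poly p (inverse x) * exp (- inverse x))"

lemma poly_times_exp_minus_tendsto_0:
  fixes p :: "real poly"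
  shows "((\<lambda>y. poly p y * exp (- y)) \<longlongrightarrow> 0) at_top"
proof -
  have "((\<lambda>y. \<Sum>i\<le>degree p. coeff p i * (y ^ i / exp y)) \<longlongrightarrow> (\<Sum>i\<le>degree p. coeff p i * 0)) at_top"
    by (intro tendsto_intros tendsto_power_div_exp_0)
  then show ?thesis
    by (simp add: poly_altdef sum_distrib_right exp_minus divide_inverse mult.assoc)
qed

text \<open>With y = 1/x and dy/dx = -y^2, the derivative of p(y) exp(-y) is y^2 (p - p')(y)
  exp(-y), so the family \<open>flat\<close> is closed under differentiation. At 0 the exponential
  beats every polynomial in y.\<close>

lemma flat_has_real_derivative:
  "(flat p has_real_derivative flat ([:0, 0, 1:] * (p - pderiv p)) x) (at x)"
proof -
  consider "x < 0" | "x > 0" | "x = 0" by linarith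
  then show ?thesis
  proof cases
    case 1
    have "((\<lambda>_. 0) has_real_derivative 0) (at x)" by simp
    then have "(flat p has_real_derivative 0) (at x)"
      by (rule has_field_derivative_transform_within_open[of _ _ _ "{..<0}"])
         (use 1 in \<open>auto simp: flat_def\<close>)
    then show ?thesis using 1 by (simp add: flat_def)
  next
    case 2
    have "((\<lambda>x. poly p (inverse x) * exp (- inverse x)) has_real_derivative
            flat ([:0, 0, 1:] * (p - pderiv p)) x) (at x)"
      using 2 by (auto intro!: derivative_eq_intros simp: flat_def field_simps power2_eq_square)
    then show ?thesis
      by (rule has_field_derivative_transform_within_open[of _ _ _ "{0<..}"])
         (use 2 in \<open>auto simp: flat_def\<close>)
  next
    case 3
    \<comment> \<open>\<open>pCons 0 p\<close> is y * p(y): with y = 1/h, the extra factor y is the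
      division by h.\<close>
    have "((\<lambda>h. poly (pCons 0 p) (inverse h) * exp (- inverse h)) \<longlongrightarrow> 0) (at_right 0)"
      by (rule filterlim_compose[OF poly_times_exp_minus_tendsto_0 filterlim_inverse_at_top_right])
    then have r: "((\<lambda>h. flat p h / h) \<longlongrightarrow> 0) (at_right 0)"
      by (rule Lim_transform_eventually)
         (auto simp: eventually_at_right_less flat_def field_simps
               intro!: eventually_mono[OF eventually_at_right_less])
    have l: "((\<lambda>h. flat p h / h) \<longlongrightarrow> 0) (at_left 0)"
      by (rule Lim_transform_eventually[OF tendsto_const])
         (auto simp: flat_def eventually_at_filter)
    have "((\<lambda>h. flat p h / h) \<longlongrightarrow> 0) (at 0)"
      using l r by (simp add: filterlim_split_at)
    then show ?thesis using 3 by (simp add: DERIV_def flat_def)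
  qed
qed

text \<open>A class closed under differentiation consists of smooth functions, so no higher Leibniz or
  chain rule is needed.\<close>

inductive smooth_elementary :: "(real \<Rightarrow> real) \<Rightarrow> bool" where
  polynomial: "real_polynomial_function f \<Longrightarrow> smooth_elementary f"
| flat_affine: "smooth_elementary (\<lambda>x. flat p (c * x + d))"
| add: "smooth_elementary f \<Longrightarrow> smooth_elementary g \<Longrightarrow> smooth_elementary (\<lambda>x. f x + g x)"
| mult: "smooth_elementary f \<Longrightarrow> smooth_elementary g \<Longrightarrow> smooth_elementary (\<lambda>x. f x * g x)"

lemma smooth_elementary_const: "smooth_elementary (\<lambda>x. c)"
  by (simp add: real_polynomial_function.intros(2) smooth_elementary.polynomial)

lemma smooth_elementary_has_derivative:
  assumes "smooth_elementary f"
  shows "\<exists>f'. smooth_elementary f' \<and> (\<forall>x. (f has_real_derivative f' x) (at x))"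
  using assms
proof induction
  case (polynomial f)
  then obtain f' where "real_polynomial_function f'" "\<And>x. (f has_real_derivative f' x) (at x)"
    using has_real_derivative_polynomial_function by blast
  then show ?case using smooth_elementary.polynomial by blast
next
  case (flat_affine p c d)
  let ?q = "[:0, 0, 1:] * (p - pderiv p)"
  have "smooth_elementary (\<lambda>x. flat ?q (c * x + d) * c)"
    by (intro smooth_elementary.mult smooth_elementary.flat_affine smooth_elementary_const)
  moreover have "((\<lambda>x. flat p (c * x + d)) has_real_derivative flat ?q (c * x + d) * c) (at x)" for x
    by (rule DERIV_chain2[OF flat_has_real_derivative]) (auto intro!: derivative_eq_intros)
  ultimately show ?case by blast
next
  case (add f g)
  then obtain f' g' where "smooth_elementary f'" "smooth_elementary g'"
    "\<And>x. (f has_real_derivative f' x) (at x)" "\<And>x. (g has_real_derivative g' x) (at x)"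
    by blast
  then show ?case
    by (intro exI[of _ "\<lambda>x. f' x + g' x"]) (auto intro!: derivative_eq_intros smooth_elementary.add)
next
  case (mult f g)
  then obtain f' g' where d: "smooth_elementary f'" "smooth_elementary g'"
    "\<And>x. (f has_real_derivative f' x) (at x)" "\<And>x. (g has_real_derivative g' x) (at x)"
    by blast
  have "smooth_elementary (\<lambda>x. f' x * g x + f x * g' x)"
    using mult.hyps d(1,2) by (intro smooth_elementary.add smooth_elementary.mult)
  with d(3,4) show ?case
    by (intro exI[of _ "\<lambda>x. f' x * g x + f x * g' x"]) (auto intro!: derivative_eq_intros)
qed

lemma smooth_elementary_iterated_deriv:
  assumes "smooth_elementary f"
  shows "smooth_elementary ((deriv ^^ k) f)"
proof (induction k)
  case 0
  then show ?case using assms by simp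
next
  case (Suc k)
  then obtain f' where f': "smooth_elementary f'" "\<And>x. ((deriv ^^ k) f has_real_derivative f' x) (at x)"
    using smooth_elementary_has_derivative by blast
  then have "deriv ((deriv ^^ k) f) = f'"
    by (intro ext DERIV_imp_deriv) auto
  then show ?case using f' by simp
qed

lemma smooth_elementary_field_differentiable:
  "smooth_elementary f \<Longrightarrow> f field_differentiable at x"
  using smooth_elementary_has_derivative field_differentiable_def by blast

lemma continuous_on_smooth_elementary: "smooth_elementary f \<Longrightarrow> continuous_on S f"
  by (meson continuous_at_imp_continuous_on field_differentiable_imp_continuous_at
      smooth_elementary_field_differentiable)

text \<open>Integrating may leave the class \<open>smooth_elementary\<close>, so only the derivative
  of \<open>F\<close> is placed in it: the higher derivatives of \<open>F\<close> are the iterated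
  derivatives of \<open>f\<close>.\<close>

lemma antiderivative_in_test_functions:
  assumes "smooth_elementary f" "\<And>x. (F has_real_derivative f x) (at x)"
    and "a < c" "d < b" "\<And>x. x \<notin> {c..d} \<Longrightarrow> F x = 0"
  shows "F \<in> test_functions a b"
proof -
  have "(deriv ^^ k) F field_differentiable at x" for k x
  proof (cases k)
    case 0
    then show ?thesis using assms(2) by (auto simp: field_differentiable_def)
  next
    case (Suc j)
    have "deriv F = f" using assms(2) by (intro ext DERIV_imp_deriv)
    then have "(deriv ^^ k) F = (deriv ^^ j) f"
      unfolding Suc funpow_Suc_right by simp
    then show ?thesis
      using smooth_elementary_iterated_deriv[OF assms(1)] smooth_elementary_field_differentiable by metis
  qed
  moreover have "{c..d} \<subseteq> {a<..<b}" using assms(3,4) by auto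
  ultimately show ?thesis
    unfolding test_functions_def using assms(5) by (auto intro!: exI[of _ "{c..d}"])
qed

section \<open>Square integrable functions and integration by parts\<close>

lemma set_integrable_Ioo_continuous:
  fixes f :: "real \<Rightarrow> real"
  assumes "continuous_on {a..b} f"
  shows "set_integrable lborel {a<..<b} f"
  by (rule set_integrable_subset[OF borel_integrable_atLeastAtMost'[OF assms]]) auto

lemma set_integral_Ioo_continuous:
  fixes f :: "real \<Rightarrow> real"
  assumes "continuous_on {a..b} f"
  shows "(LINT x:{a<..<b}|lborel. f x) = integral {a..b} f"
  using set_borel_integral_eq_integral(2)[OF set_integrable_Ioo_continuous[OF assms]]
  by (simp add: integral_open_interval_real)

lemma set_integral_Ioo_FTC:
  fixes F :: "real \<Rightarrow> real"
  assumes "a \<le> b" "continuous_on {a..b} f"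
    and "\<And>x. x \<in> {a..b} \<Longrightarrow> (F has_real_derivative f x) (at x within {a..b})"
  shows "(LINT x:{a<..<b}|lborel. f x) = F b - F a"
  unfolding set_integral_Ioo_continuous[OF assms(2)]
  by (intro integral_unique fundamental_theorem_of_calculus assms(1))
     (use assms(3) in \<open>simp add: has_real_derivative_iff_has_vector_derivative\<close>)

lemma set_integral_Ioo_const:
  fixes a b c :: real
  assumes "a \<le> b"
  shows "(LINT x:{a<..<b}|lborel. c) = (b - a) * c"
proof -
  have "(LINT x:{a<..<b}|lborel. c) = b * c - a * c"
    by (rule set_integral_Ioo_FTC[OF assms]) (auto intro!: derivative_eq_intros)
  then show ?thesis by (simp add: algebra_simps)
qed

lemma L2_continuous:
  assumes "continuous_on {a..b} f"
  shows "f \<in> L2 a b"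
proof -
  have "set_integrable lborel {a<..<b} f"
    by (rule set_integrable_Ioo_continuous[OF assms])
  moreover have "set_integrable lborel {a<..<b} (\<lambda>x. (f x)\<^sup>2)"
    by (intro set_integrable_Ioo_continuous continuous_intros assms)
  ultimately show ?thesis
    unfolding L2_def set_borel_measurable_def set_integrable_def by auto
qed

lemma L2_mult_integrable:
  assumes "f \<in> L2 a b" "g \<in> L2 a b"
  shows "set_integrable lborel {a<..<b} (\<lambda>x. f x * g x)"
proof -
  let ?I = "indicator {a<..<b} :: real \<Rightarrow> real"
  have m: "(\<lambda>x. ?I x *\<^sub>R f x) \<in> borel_measurable lborel" "(\<lambda>x. ?I x *\<^sub>R g x) \<in> borel_measurable lborel"
    and i: "integrable lborel (\<lambda>x. ?I x *\<^sub>R (f x)\<^sup>2)" "integrable lborel (\<lambda>x. ?I x *\<^sub>R (g x)\<^sup>2)"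
    using assms by (auto simp: L2_def set_borel_measurable_def set_integrable_def)
  have "integrable lborel (\<lambda>x. (?I x *\<^sub>R f x) * (?I x *\<^sub>R g x))"
  proof (rule Bochner_Integration.integrable_bound[OF Bochner_Integration.integrable_add[OF i]])
    show "(\<lambda>x. (?I x *\<^sub>R f x) * (?I x *\<^sub>R g x)) \<in> borel_measurable lborel"
      using m by (rule borel_measurable_times)
    show "AE x in lborel. norm ((?I x *\<^sub>R f x) * (?I x *\<^sub>R g x))
            \<le> norm (?I x *\<^sub>R (f x)\<^sup>2 + ?I x *\<^sub>R (g x)\<^sup>2)"
    proof (rule AE_I2)
      fix x
      have "2 * (\<bar>f x\<bar> * \<bar>g x\<bar>) \<le> (f x)\<^sup>2 + (g x)\<^sup>2"
        using sum_squares_bound[of "\<bar>f x\<bar>" "\<bar>g x\<bar>"] by simp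
      moreover have "0 \<le> \<bar>f x\<bar> * \<bar>g x\<bar>" by simp
      ultimately have "\<bar>f x\<bar> * \<bar>g x\<bar> \<le> (f x)\<^sup>2 + (g x)\<^sup>2" by linarith
      then show "norm ((?I x *\<^sub>R f x) * (?I x *\<^sub>R g x))
            \<le> norm (?I x *\<^sub>R (f x)\<^sup>2 + ?I x *\<^sub>R (g x)\<^sup>2)"
        by (simp add: indicator_def abs_mult)
    qed
  qed
  then show ?thesis
    unfolding set_integrable_def
    by (rule Bochner_Integration.integrable_cong[THEN iffD1, rotated 2]) (auto simp: indicator_def)
qed

lemma L2_cmult:
  assumes "f \<in> L2 a b"
  shows "(\<lambda>x. c * f x) \<in> L2 a b"
proof -
  have "(\<lambda>x. c * (indicator {a<..<b} x *\<^sub>R f x)) \<in> borel_measurable lborel"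
    using assms unfolding L2_def set_borel_measurable_def by (intro borel_measurable_times) auto
  moreover have "set_integrable lborel {a<..<b} (\<lambda>x. c\<^sup>2 * (f x)\<^sup>2)"
    using assms by (intro set_integrable_mult_right) (auto simp: L2_def)
  ultimately show ?thesis
    by (simp add: L2_def set_borel_measurable_def power_mult_distrib mult.left_commute)
qed

lemma L2_add:
  assumes "f \<in> L2 a b" "g \<in> L2 a b"
  shows "(\<lambda>x. f x + g x) \<in> L2 a b"
proof -
  have "(\<lambda>x. indicator {a<..<b} x *\<^sub>R f x + indicator {a<..<b} x *\<^sub>R g x) \<in> borel_measurable lborel"
    using assms unfolding L2_def set_borel_measurable_def by (intro borel_measurable_add) auto
  moreover have "set_integrable lborel {a<..<b} (\<lambda>x. ((f x)\<^sup>2 + (g x)\<^sup>2) + 2 * (f x * g x))"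
    using assms by (intro set_integral_add(1) set_integrable_mult_right L2_mult_integrable)
      (auto simp: L2_def)
  ultimately show ?thesis
    by (simp add: L2_def set_borel_measurable_def power2_sum mult.assoc distrib_left)
qed

lemma L2_diff:
  assumes "f \<in> L2 a b" "g \<in> L2 a b"
  shows "(\<lambda>x. f x - g x) \<in> L2 a b"
  using L2_add[OF assms(1) L2_cmult[OF assms(2), of "-1"]] by simp

text \<open>The quadratic t -> integral of (f + t g)^2 is nonnegative; it is evaluated at its
  minimum -B/C unless C = 0.\<close>

lemma L2_Cauchy_Schwarz:
  assumes "f \<in> L2 a b" "g \<in> L2 a b"
  shows "(LINT x:{a<..<b}|lborel. f x * g x)\<^sup>2
    \<le> (LINT x:{a<..<b}|lborel. (f x)\<^sup>2) * (LINT x:{a<..<b}|lborel. (g x)\<^sup>2)"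
proof -
  define A where "A = (LINT x:{a<..<b}|lborel. (f x)\<^sup>2)"
  define B where "B = (LINT x:{a<..<b}|lborel. f x * g x)"
  define C where "C = (LINT x:{a<..<b}|lborel. (g x)\<^sup>2)"
  have i: "set_integrable lborel {a<..<b} (\<lambda>x. (f x)\<^sup>2)" "set_integrable lborel {a<..<b} (\<lambda>x. (g x)\<^sup>2)"
    "set_integrable lborel {a<..<b} (\<lambda>x. f x * g x)"
    using assms L2_mult_integrable by (auto simp: L2_def)
  have q: "0 \<le> A + 2 * t * B + t\<^sup>2 * C" for t
  proof -
    have "0 \<le> (LINT x:{a<..<b}|lborel. (f x + t * g x)\<^sup>2)"
      unfolding set_lebesgue_integral_def by (rule integral_nonneg_AE) auto
    also have "\<dots> = (LINT x:{a<..<b}|lborel. ((f x)\<^sup>2 + 2 * t * (f x * g x)) + t\<^sup>2 * (g x)\<^sup>2)"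
      by (simp add: power2_eq_square algebra_simps)
    also have "\<dots> = A + 2 * t * B + t\<^sup>2 * C"
      unfolding A_def B_def C_def using i
      by (subst set_integral_add(2), simp, simp)+ simp
    finally show ?thesis .
  qed
  have "C \<ge> 0" unfolding C_def set_lebesgue_integral_def by (rule integral_nonneg_AE) auto
  have "B\<^sup>2 \<le> A * C"
  proof (cases "C = 0")
    case True
    have "B = 0"
    proof (rule ccontr)
      assume "B \<noteq> 0"
      \<comment> \<open>This t makes A + 2 t B equal to -1.\<close>
      then show False using q[of "- (A + 1) / (2 * B)"] True by (simp add: field_simps)
    qed
    then show ?thesis using True by simp
  next
    case False
    then have "C > 0" using \<open>C \<ge> 0\<close> by simp
    then show ?thesis using q[of "- B / C"] by (simp add: field_simps power2_eq_square)
  qed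
  then show ?thesis by (simp add: A_def B_def C_def)
qed

lemma L2_tendsto_mult_0:
  assumes "\<And>n. f n \<in> L2 a b" "\<And>n. g n \<in> L2 a b"
    and "(\<lambda>n. (LINT x:{a<..<b}|lborel. (f n x)\<^sup>2) * (LINT x:{a<..<b}|lborel. (g n x)\<^sup>2)) \<longlonglongrightarrow> 0"
  shows "(\<lambda>n. LINT x:{a<..<b}|lborel. f n x * g n x) \<longlonglongrightarrow> 0"
proof -
  have "(\<lambda>n. (LINT x:{a<..<b}|lborel. f n x * g n x)\<^sup>2) \<longlonglongrightarrow> 0"
    by (rule tendsto_sandwich[OF _ _ tendsto_const assms(3)])
       (auto intro!: always_eventually L2_Cauchy_Schwarz assms)
  then show ?thesis by simp
qed

text \<open>Continuity of the L^2 inner product: it carries integral identities and inequalities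
  from approximating test functions to their limits.\<close>

lemma L2_tendsto_mult:
  assumes f: "\<And>n. f n \<in> L2 a b" "f' \<in> L2 a b" "(\<lambda>n. LINT x:{a<..<b}|lborel. (f n x - f' x)\<^sup>2) \<longlonglongrightarrow> 0"
    and g: "\<And>n. g n \<in> L2 a b" "g' \<in> L2 a b" "(\<lambda>n. LINT x:{a<..<b}|lborel. (g n x - g' x)\<^sup>2) \<longlonglongrightarrow> 0"
  shows "(\<lambda>n. LINT x:{a<..<b}|lborel. f n x * g n x) \<longlonglongrightarrow> (LINT x:{a<..<b}|lborel. f' x * g' x)"
proof -
  note df = L2_diff[OF f(1,2)] and dg = L2_diff[OF g(1,2)]
  let ?L = "\<lambda>h. LINT x:{a<..<b}|lborel. h x"
  have "(\<lambda>n. ?L (\<lambda>x. (f n x - f' x) * (g n x - g' x)) + ?L (\<lambda>x. f' x * (g n x - g' x))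
           + ?L (\<lambda>x. (f n x - f' x) * g' x) + ?L (\<lambda>x. f' x * g' x)) \<longlonglongrightarrow> 0 + 0 + 0 + ?L (\<lambda>x. f' x * g' x)"
    by (intro tendsto_add tendsto_const L2_tendsto_mult_0 df dg f g
          tendsto_mult_zero[OF f(3) g(3)] tendsto_mult_left_zero[OF f(3)] tendsto_mult_right_zero[OF g(3)])
  moreover have "?L (\<lambda>x. f n x * g n x)
      = ?L (\<lambda>x. (f n x - f' x) * (g n x - g' x)) + ?L (\<lambda>x. f' x * (g n x - g' x))
           + ?L (\<lambda>x. (f n x - f' x) * g' x) + ?L (\<lambda>x. f' x * g' x)" for n
  proof -
    have "?L (\<lambda>x. f n x * g n x) = ?L (\<lambda>x. (f n x - f' x) * (g n x - g' x) + f' x * (g n x - g' x)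
           + (f n x - f' x) * g' x + f' x * g' x)"
      by (simp add: algebra_simps)
    also have "\<dots> = ?L (\<lambda>x. (f n x - f' x) * (g n x - g' x)) + ?L (\<lambda>x. f' x * (g n x - g' x))
           + ?L (\<lambda>x. (f n x - f' x) * g' x) + ?L (\<lambda>x. f' x * g' x)"
      by (subst set_integral_add(2);
          (intro set_integral_add(1) L2_mult_integrable df dg f g)?)+ simp
    finally show ?thesis .
  qed
  ultimately show ?thesis by simp
qed

section \<open>Test functions and integration by parts\<close>

lemma test_function_facts:
  assumes "\<phi> \<in> test_functions a b"
  shows "(\<phi> has_real_derivative deriv \<phi> x) (at x)"
    and "continuous_on S \<phi>" "continuous_on S (deriv \<phi>)" "\<phi> a = 0" "\<phi> b = 0"
    and "\<phi> \<in> L2 c d" "deriv \<phi> \<in> L2 c d"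
proof -
  have d: "(deriv ^^ k) \<phi> field_differentiable at x" for k x
    using assms by (simp add: test_functions_def)
  show "(\<phi> has_real_derivative deriv \<phi> x) (at x)"
    using d[of 0 x] by (simp add: field_differentiable_derivI)
  show c: "continuous_on S \<phi>" for S
    using d[of 0] by (auto intro!: continuous_at_imp_continuous_on field_differentiable_imp_continuous_at)
  show c': "continuous_on S (deriv \<phi>)" for S
    using d[of 1] by (auto intro!: continuous_at_imp_continuous_on field_differentiable_imp_continuous_at)
  show "\<phi> \<in> L2 c d" "deriv \<phi> \<in> L2 c d" by (intro L2_continuous c c')+
  obtain K where "K \<subseteq> {a<..<b}" "\<forall>x. x \<notin> K \<longrightarrow> \<phi> x = 0"
    using assms by (auto simp: test_functions_def)
  then show "\<phi> a = 0" "\<phi> b = 0" by (metis greaterThanLessThan_iff less_irrefl subset_iff)+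
qed

lemma test_function_integration_by_parts:
  assumes "a \<le> b" "continuous_on {a..b} v" "\<phi> \<in> test_functions a b"
    and u: "\<And>x. x \<in> {a..b} \<Longrightarrow> (u has_real_derivative v x) (at x within {a..b})"
  shows "(LINT x:{a<..<b}|lborel. u x * deriv \<phi> x) = - (LINT x:{a<..<b}|lborel. v x * \<phi> x)"
proof -
  note \<phi> = test_function_facts[OF assms(3)]
  have cu: "continuous_on {a..b} u"
    using u by (meson DERIV_continuous continuous_on_eq_continuous_within)
  have "(LINT x:{a<..<b}|lborel. u x * deriv \<phi> x + v x * \<phi> x) = u b * \<phi> b - u a * \<phi> a"
    by (rule set_integral_Ioo_FTC[OF assms(1)])
       (auto intro!: continuous_intros derivative_eq_intros u DERIV_subset[OF \<phi>(1)] \<phi> cu assms(2))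
  then have "(LINT x:{a<..<b}|lborel. u x * deriv \<phi> x) + (LINT x:{a<..<b}|lborel. v x * \<phi> x) = 0"
    using \<phi> by (subst (asm) set_integral_add(2))
       (auto intro!: set_integrable_Ioo_continuous continuous_intros cu assms(2))
  then show ?thesis by simp
qed

lemma weak_derivative_C1:
  assumes "a \<le> b" "continuous_on {a..b} v"
    and "\<And>x. x \<in> {a..b} \<Longrightarrow> (u has_real_derivative v x) (at x within {a..b})"
  shows "weak_derivative a b u v"
  unfolding weak_derivative_def
  by (intro conjI ballI L2_continuous test_function_integration_by_parts assms
      DERIV_continuous_on[OF assms(3)])

section \<open>Approximation by test functions\<close>

text \<open>\<open>flat 1\<close> vanishes up to 0 and tends to 1 at infinity, so the product
  vanishes within 1/(n+1) of either endpoint and tends to 1 at each interior point. It never equals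
  1; pointwise convergence is enough under dominated convergence.\<close>

definition cutoff :: "real \<Rightarrow> real \<Rightarrow> nat \<Rightarrow> real \<Rightarrow> real" where
  "cutoff a b n x = flat 1 (real (Suc n) * (x - a) - 1) * flat 1 (real (Suc n) * (b - x) - 1)"

lemma flat_1_bounds: "0 \<le> flat 1 x" "flat 1 x \<le> 1"
  by (auto simp: flat_def)

lemma cutoff_bounds: "0 \<le> cutoff a b n x" "cutoff a b n x \<le> 1"
  unfolding cutoff_def by (auto intro!: mult_nonneg_nonneg mult_le_one flat_1_bounds)

lemma smooth_elementary_cutoff: "smooth_elementary (cutoff a b n)"
proof -
  have "cutoff a b n = (\<lambda>x. flat 1 (real (Suc n) * x + (- (real (Suc n) * a) - 1))
      * flat 1 ((- real (Suc n)) * x + (real (Suc n) * b - 1)))"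
    by (auto simp: cutoff_def fun_eq_iff algebra_simps)
  then show ?thesis
    by (metis smooth_elementary.flat_affine smooth_elementary.mult)
qed

lemma cutoff_eq_0:
  assumes "x \<notin> {a + 1 / Suc n..b - 1 / Suc n}"
  shows "cutoff a b n x = 0"
proof -
  have "real (Suc n) * (x - a) - 1 \<le> 0 \<or> real (Suc n) * (b - x) - 1 \<le> 0"
    using assms by (auto simp: field_simps simp del: of_nat_Suc)
  then show ?thesis by (auto simp: cutoff_def flat_def)
qed

lemma flat_1_tendsto_1:
  assumes "y > 0"
  shows "(\<lambda>n. flat 1 (real (Suc n) * y - 1)) \<longlonglongrightarrow> 1"
proof -
  have 1: "filterlim (\<lambda>n. real (Suc n)) at_top sequentially"
    by (rule filterlim_compose[OF filterlim_real_sequentially filterlim_Suc])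
  have t: "filterlim (\<lambda>n. real (Suc n) * y - 1) at_top sequentially"
    using filterlim_tendsto_add_at_top[OF tendsto_const filterlim_at_top_mult_tendsto_pos[OF tendsto_const assms 1], of "-1"]
    by (simp add: algebra_simps)
  have "(\<lambda>n. exp (- inverse (real (Suc n) * y - 1))) \<longlonglongrightarrow> exp (- 0)"
    by (intro tendsto_intros filterlim_compose[OF tendsto_inverse_0_at_top t]) (rule filterlim_ident)
  moreover have "\<forall>\<^sub>F n in sequentially. real (Suc n) * y - 1 > 0"
    using t by (simp only: filterlim_at_top_dense)
  then have "\<forall>\<^sub>F n in sequentially. exp (- inverse (real (Suc n) * y - 1)) = flat 1 (real (Suc n) * y - 1)"
    by eventually_elim (simp add: flat_def)
  ultimately show ?thesis using Lim_transform_eventually by fastforce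
qed

lemma cutoff_tendsto_1: "x \<in> {a<..<b} \<Longrightarrow> (\<lambda>n. cutoff a b n x) \<longlonglongrightarrow> 1"
  using tendsto_mult[OF flat_1_tendsto_1[of "x - a"] flat_1_tendsto_1[of "b - x"]]
  by (simp add: cutoff_def)

text \<open>Membership in \<open>smooth_elementary\<close> is recorded so that bumps can be combined
  linearly and integrated to test functions. With \<open>c > d\<close> the interval is empty and
  \<open>\<psi>\<close> is 0, which covers the first cutoffs on a short interval.\<close>

definition smooth_bump :: "real \<Rightarrow> real \<Rightarrow> (real \<Rightarrow> real) \<Rightarrow> bool" where
  "smooth_bump a b \<psi> \<longleftrightarrow> smooth_elementary \<psi> \<and> (\<exists>c d. a < c \<and> d < b \<and> (\<forall>x. x \<notin> {c..d} \<longrightarrow> \<psi> x = 0))"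

lemma smooth_bump_add_cmult:
  assumes "smooth_bump a b f" "smooth_bump a b g"
  shows "smooth_bump a b (\<lambda>x. f x + t * g x)"
proof -
  obtain c d c' d' where "a < c" "d < b" "\<forall>x. x \<notin> {c..d} \<longrightarrow> f x = 0"
      "a < c'" "d' < b" "\<forall>x. x \<notin> {c'..d'} \<longrightarrow> g x = 0"
    using assms by (auto simp: smooth_bump_def)
  then have "a < min c c'" "max d d' < b" "\<forall>x. x \<notin> {min c c'..max d d'} \<longrightarrow> f x + t * g x = 0"
    by (auto simp: not_le)
  moreover have "smooth_elementary (\<lambda>x. f x + t * g x)"
    using assms unfolding smooth_bump_def
    by (intro smooth_elementary.add smooth_elementary.mult smooth_elementary_const) auto
  ultimately show ?thesis
    unfolding smooth_bump_def by blast
qed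

text \<open>Stone-Weierstrass polynomials approximate \<open>v\<close> uniformly, the cutoffs give
  them compact support, and dominated convergence turns pointwise into L^2 convergence.\<close>

lemma smooth_bumps_dense_L2:
  assumes "continuous_on {a..b} v"
  obtains \<psi> :: "nat \<Rightarrow> real \<Rightarrow> real" where "\<And>n. smooth_bump a b (\<psi> n)"
    "(\<lambda>n. LINT x:{a<..<b}|lborel. (\<psi> n x - v x)\<^sup>2) \<longlonglongrightarrow> 0"
proof -
  have "\<forall>n. \<exists>p. real_polynomial_function p \<and> (\<forall>x\<in>{a..b}. \<bar>v x - p x\<bar> < 1 / Suc n)"
    using Stone_Weierstrass_real_polynomial_function[OF compact_Icc assms, of "1 / Suc n" for n]
    by (metis zero_less_divide_1_iff of_nat_0_less_iff zero_less_Suc)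
  then obtain p where p: "\<And>n. real_polynomial_function (p n)"
      "\<And>n x. x \<in> {a..b} \<Longrightarrow> \<bar>v x - p n x\<bar> < 1 / Suc n"
    by metis
  obtain M where M: "\<And>x. x \<in> {a..b} \<Longrightarrow> \<bar>v x\<bar> \<le> M"
    using compact_imp_bounded[OF compact_continuous_image[OF assms compact_Icc]]
    by (force simp: bounded_iff)
  define \<psi> where "\<psi> = (\<lambda>n x. p n x * cutoff a b n x)"
  have elem: "smooth_elementary (\<psi> n)" for n
    unfolding \<psi>_def by (intro smooth_elementary.mult smooth_elementary.polynomial p smooth_elementary_cutoff)
  have bump: "smooth_bump a b (\<psi> n)" for n
    unfolding smooth_bump_def
    by (intro conjI elem exI[of _ "a + 1 / Suc n"] exI[of _ "b - 1 / Suc n"])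
       (auto simp: \<psi>_def cutoff_eq_0 simp del: of_nat_Suc)
  have lim: "(\<lambda>n. \<psi> n x) \<longlonglongrightarrow> v x" if x: "x \<in> {a<..<b}" for x
  proof -
    have "(\<lambda>n. v x - p n x) \<longlonglongrightarrow> 0"
      by (rule Lim_null_comparison[OF _ LIMSEQ_inverse_real_of_nat])
         (use p(2)[of x] x in \<open>auto intro!: always_eventually less_imp_le simp: inverse_eq_divide simp del: of_nat_Suc\<close>)
    then have "(\<lambda>n. v x - (v x - p n x)) \<longlonglongrightarrow> v x - 0"
      by (intro tendsto_diff tendsto_const)
    then have "(\<lambda>n. p n x * cutoff a b n x) \<longlonglongrightarrow> v x * 1"
      by (intro tendsto_mult cutoff_tendsto_1 x) simp
    then show ?thesis by (simp add: \<psi>_def)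
  qed
  \<comment> \<open>From |psi| <= |p| <= M + 1 and |v| <= M.\<close>
  have bound: "\<bar>\<psi> n x - v x\<bar> \<le> 2 * M + 1" if x: "x \<in> {a..b}" for n x
  proof -
    have "1 / Suc n \<le> (1::real)" by simp
    then have p1: "\<bar>p n x\<bar> \<le> M + 1" using p(2)[OF x, of n] M[OF x] by linarith
    have "\<bar>\<psi> n x\<bar> = \<bar>p n x\<bar> * cutoff a b n x" using cutoff_bounds(1) by (simp add: \<psi>_def abs_mult)
    also have "\<dots> \<le> \<bar>p n x\<bar>" by (rule mult_right_le_one_le) (auto simp: cutoff_bounds)
    finally show ?thesis using p1 M[OF x] by linarith
  qed
  have cont: "continuous_on {a..b} (\<lambda>x. (\<psi> n x - v x)\<^sup>2)" for n
    by (intro continuous_intros assms continuous_on_smooth_elementary[OF elem])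
  have "(\<lambda>n. LINT x|lborel. indicator {a<..<b} x *\<^sub>R (\<psi> n x - v x)\<^sup>2) \<longlonglongrightarrow> (LINT (x::real)|lborel. (0::real))"
  proof (rule integral_dominated_convergence[where w="\<lambda>x. indicator {a<..<b} x *\<^sub>R (2 * M + 1)\<^sup>2"])
    show "(\<lambda>x. indicator {a<..<b} x *\<^sub>R (\<psi> n x - v x)\<^sup>2) \<in> borel_measurable lborel" for n
      using set_integrable_Ioo_continuous[OF cont] unfolding set_integrable_def by auto
    show "integrable lborel (\<lambda>x. indicator {a<..<b} x *\<^sub>R (2 * M + 1)\<^sup>2)"
      using set_integrable_Ioo_continuous[of a b "\<lambda>_. (2 * M + 1)\<^sup>2"] unfolding set_integrable_def by auto
    show "AE x in lborel. (\<lambda>n. indicator {a<..<b} x *\<^sub>R (\<psi> n x - v x)\<^sup>2) \<longlonglongrightarrow> 0"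
    proof (rule AE_I2)
      fix x
      show "(\<lambda>n. indicator {a<..<b} x *\<^sub>R (\<psi> n x - v x)\<^sup>2) \<longlonglongrightarrow> 0"
      proof (cases "x \<in> {a<..<b}")
        case True
        then have "(\<lambda>n. (\<psi> n x - v x)\<^sup>2) \<longlonglongrightarrow> (v x - v x)\<^sup>2"
          by (intro tendsto_intros lim)
        then show ?thesis using True by simp
      qed simp
    qed
    show "AE x in lborel. norm (indicator {a<..<b} x *\<^sub>R (\<psi> n x - v x)\<^sup>2) \<le> indicator {a<..<b} x *\<^sub>R (2 * M + 1)\<^sup>2" for n
    proof (rule AE_I2)
      fix x
      show "norm (indicator {a<..<b} x *\<^sub>R (\<psi> n x - v x)\<^sup>2) \<le> indicator {a<..<b} x *\<^sub>R (2 * M + 1)\<^sup>2"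
        using bound[of x n] by (auto simp: indicator_def abs_le_square_iff[symmetric])
    qed
  qed auto
  then show ?thesis
    using that[OF bump] by (simp add: set_lebesgue_integral_def)
qed

text \<open>On either side of the support of \<open>g\<close> an antiderivative is constant; the
  vanishing integral makes the two constants agree, so subtracting one number removes both.\<close>

lemma smooth_bump_antiderivative:
  assumes "a < b" "smooth_bump a b g" "(LINT x:{a<..<b}|lborel. g x) = 0"
  obtains \<phi> where "\<phi> \<in> test_functions a b" "\<And>x. (\<phi> has_real_derivative g x) (at x)"
proof -
  obtain c d where g: "smooth_elementary g" and cd: "a < c" "d < b" "\<And>x. x \<notin> {c..d} \<Longrightarrow> g x = 0"
    using assms by (auto simp: smooth_bump_def)
  have "isCont g x" for x
    using continuous_on_smooth_elementary[OF g, of UNIV] by (simp add: continuous_on_eq_continuous_at)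
  then obtain F where F: "\<And>x. (F has_vector_derivative g x) (at x)"
    using einterval_antiderivative[of "-\<infinity>" \<infinity> g] by auto
  then have F: "(F has_real_derivative g x) (at x)" for x
    by (simp add: has_real_derivative_iff_has_vector_derivative)
  have "F b - F a = 0"
    using assms(1,3) set_integral_Ioo_FTC[of a b g F] DERIV_subset[OF F] continuous_on_smooth_elementary[OF g]
    by simp
  have const: "F y = F x" if "x \<le> y" "\<And>z. z \<in> {x..y} \<Longrightarrow> g z = 0" for x y
  proof (cases "x = y")
    case False
    show ?thesis
    proof (rule DERIV_isconst_end[of x y F])
      show "continuous_on {x..y} F" using F by (meson DERIV_subset DERIV_continuous_on subset_UNIV)
      show "(F has_real_derivative 0) (at z)" if "x < z" "z < y" for z
        using F[of z] \<open>\<And>z. z \<in> {x..y} \<Longrightarrow> g z = 0\<close>[of z] that by simp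
    qed (use False that in auto)
  qed simp
  have "F x - F a = 0" if x: "x \<notin> {c..d}" for x
  proof (cases "x < c")
    case True
    show ?thesis
      using const[of a x] const[of x a] cd True by (cases "a \<le> x") auto
  next
    case False
    then have "d < x" using x by auto
    then have "F x = F b"
      using const[of b x] const[of x b] cd by (cases "b \<le> x") auto
    then show ?thesis using \<open>F b - F a = 0\<close> by simp
  qed
  then have "(\<lambda>x. F x - F a) \<in> test_functions a b"
    by (intro antiderivative_in_test_functions[OF g _ cd(1,2)]) (auto intro!: derivative_eq_intros F)
  then show ?thesis
    by (rule that) (auto intro!: derivative_eq_intros F)
qed

text \<open>Approximate \<open>v\<close> in \<open>L\<^sup>2\<close> by bumps, correct their means to \<open>0\<close> with a multiple of a fixed bump
  \<open>\<eta>\<close>, and integrate.\<close>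

lemma C1_in_H10:
  assumes ab: "a < b" and v: "continuous_on {a..b} v"
    and u: "\<And>x. x \<in> {a..b} \<Longrightarrow> (u has_real_derivative v x) (at x within {a..b})"
    and u0: "u a = 0" "u b = 0"
  shows "u \<in> H10 a b"
proof -
  let ?L = "\<lambda>h. LINT x:{a<..<b}|lborel. h x"
  have cu: "continuous_on {a..b} u" using u by (rule DERIV_continuous_on)
  have cont_bump: "continuous_on S f" if "smooth_bump a b f" for f S
    using that continuous_on_smooth_elementary by (auto simp: smooth_bump_def)
  have one: "(\<lambda>x. 1) \<in> L2 a b" by (intro L2_continuous continuous_intros)
  have int: "(\<lambda>n. ?L (\<psi> n)) \<longlonglongrightarrow> ?L w" if "\<And>n. smooth_bump a b (\<psi> n)" "continuous_on {a..b} w"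
    "(\<lambda>n. ?L (\<lambda>x. (\<psi> n x - w x)\<^sup>2)) \<longlonglongrightarrow> 0" for \<psi> w
    using L2_tendsto_mult[OF L2_continuous[OF cont_bump[OF that(1)]] L2_continuous[OF that(2)] that(3) one one]
    by simp
  \<comment> \<open>Bumps approximating the constant 1 have integrals tending to b - a > 0, so one
    of them can serve as \<open>\<eta>\<close>.\<close>
  obtain \<xi> where \<xi>: "\<And>n. smooth_bump a b (\<xi> n)" "(\<lambda>n. ?L (\<lambda>x. (\<xi> n x - 1)\<^sup>2)) \<longlonglongrightarrow> 0"
    using smooth_bumps_dense_L2[of a b "\<lambda>x. 1"] by auto
  have "?L (\<lambda>x. 1) = b - a"
    using ab by (simp add: set_integral_Ioo_const)
  then have "(\<lambda>n. ?L (\<xi> n)) \<longlonglongrightarrow> b - a"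
    using int[OF \<xi>(1) _ \<xi>(2)] by simp
  then have "\<forall>\<^sub>F n in sequentially. ?L (\<xi> n) > 0"
    using ab by (intro order_tendstoD(1)) auto
  then obtain \<eta> where \<eta>: "smooth_bump a b \<eta>" "?L \<eta> > 0"
    using \<xi>(1) by (auto simp: eventually_sequentially)
  obtain \<psi> where \<psi>: "\<And>n. smooth_bump a b (\<psi> n)" "(\<lambda>n. ?L (\<lambda>x. (\<psi> n x - v x)\<^sup>2)) \<longlonglongrightarrow> 0"
    using smooth_bumps_dense_L2[OF v] by auto
  \<comment> \<open>The boundary values enter here: \<open>v\<close> has mean 0, so the corrections
    \<open>t n\<close> tend to 0 and do not spoil the approximation.\<close>
  have "?L v = 0"
    using set_integral_Ioo_FTC[OF _ v u] ab u0 by simp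
  then have m: "(\<lambda>n. ?L (\<psi> n)) \<longlonglongrightarrow> 0"
    using int[OF \<psi>(1) v \<psi>(2)] by simp
  define t where "t = (\<lambda>n. - (?L (\<psi> n) / ?L \<eta>))"
  have t0: "t \<longlonglongrightarrow> 0"
    using tendsto_minus[OF tendsto_divide[OF m tendsto_const]] \<eta>(2) by (simp add: t_def)
  define g where "g = (\<lambda>n x. \<psi> n x + t n * \<eta> x)"
  have g: "smooth_bump a b (g n)" for n
    unfolding g_def by (intro smooth_bump_add_cmult \<psi> \<eta>)
  have "?L (g n) = 0" for n
  proof -
    have "?L (g n) = ?L (\<psi> n) + t n * ?L \<eta>"
      unfolding g_def by (subst set_integral_add(2))
         (simp_all add: set_integrable_Ioo_continuous set_integrable_mult_right cont_bump[OF \<psi>(1)] cont_bump[OF \<eta>(1)])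
    then show ?thesis using \<eta>(2) by (simp add: t_def)
  qed
  then have "\<forall>n. \<exists>\<phi>. \<phi> \<in> test_functions a b \<and> (\<forall>x. (\<phi> has_real_derivative g n x) (at x))"
    using smooth_bump_antiderivative[OF ab g] by metis
  then obtain \<phi> where \<phi>: "\<And>n. \<phi> n \<in> test_functions a b" "\<And>n x. (\<phi> n has_real_derivative g n x) (at x)"
    by metis
  have d\<phi>: "deriv (\<phi> n) = g n" for n
    using \<phi>(2) by (intro ext DERIV_imp_deriv)
  define w where "w = (\<lambda>n x. g n x - v x)"
  have cw: "continuous_on {a..b} (w n)" for n
    unfolding w_def by (intro continuous_intros v cont_bump g)
  have sq: "continuous_on {a..b} (\<lambda>x. (h x)\<^sup>2)" if "continuous_on {a..b} h" for h :: "real \<Rightarrow> real"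
    using that by (intro continuous_intros)
  have w0: "(\<lambda>n. ?L (\<lambda>x. (w n x)\<^sup>2)) \<longlonglongrightarrow> 0"
  proof -
    have "(\<lambda>n. 2 * ?L (\<lambda>x. (\<psi> n x - v x)\<^sup>2) + 2 * (t n)\<^sup>2 * ?L (\<lambda>x. (\<eta> x)\<^sup>2)) \<longlonglongrightarrow> 2 * 0 + 2 * 0\<^sup>2 * ?L (\<lambda>x. (\<eta> x)\<^sup>2)"
      by (intro tendsto_intros \<psi>(2) t0)
    then have lim: "(\<lambda>n. 2 * ?L (\<lambda>x. (\<psi> n x - v x)\<^sup>2) + 2 * (t n)\<^sup>2 * ?L (\<lambda>x. (\<eta> x)\<^sup>2)) \<longlonglongrightarrow> 0"
      by simp
    \<comment> \<open>Integrated form of (x + y)^2 <= 2 x^2 + 2 y^2.\<close>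
    have "?L (\<lambda>x. (w n x)\<^sup>2) \<le> 2 * ?L (\<lambda>x. (\<psi> n x - v x)\<^sup>2) + 2 * (t n)\<^sup>2 * ?L (\<lambda>x. (\<eta> x)\<^sup>2)" for n
    proof -
      have i: "set_integrable lborel {a<..<b} (\<lambda>x. (\<psi> n x - v x)\<^sup>2)" "set_integrable lborel {a<..<b} (\<lambda>x. (\<eta> x)\<^sup>2)"
        by (intro set_integrable_Ioo_continuous sq continuous_intros cont_bump \<psi> \<eta> v)+
      have "?L (\<lambda>x. (w n x)\<^sup>2) \<le> ?L (\<lambda>x. 2 * (\<psi> n x - v x)\<^sup>2 + 2 * (t n)\<^sup>2 * (\<eta> x)\<^sup>2)"
      proof (rule set_integral_mono)
        show "set_integrable lborel {a<..<b} (\<lambda>x. 2 * (\<psi> n x - v x)\<^sup>2 + 2 * (t n)\<^sup>2 * (\<eta> x)\<^sup>2)"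
          using i by (intro set_integral_add(1)) auto
        show "(w n x)\<^sup>2 \<le> 2 * (\<psi> n x - v x)\<^sup>2 + 2 * (t n)\<^sup>2 * (\<eta> x)\<^sup>2" for x
          using sum_squares_bound[of "\<psi> n x - v x" "t n * \<eta> x"]
          by (simp add: w_def g_def power2_sum power2_eq_square algebra_simps)
      qed (intro set_integrable_Ioo_continuous sq cw)
      also have "\<dots> = 2 * ?L (\<lambda>x. (\<psi> n x - v x)\<^sup>2) + 2 * (t n)\<^sup>2 * ?L (\<lambda>x. (\<eta> x)\<^sup>2)"
        using i by (subst set_integral_add(2)) auto
      finally show ?thesis .
    qed
    then show ?thesis
      by (intro tendsto_sandwich[OF _ _ tendsto_const lim] always_eventually allI)
         (auto simp: set_lebesgue_integral_def intro!: integral_nonneg_AE)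
  qed
  \<comment> \<open>\<open>\<phi> n\<close> and \<open>u\<close> both vanish at \<open>a\<close>, so
    their difference at \<open>x\<close> is the integral of \<open>w n\<close> over (a, x);
    Cauchy-Schwarz against 1 bounds it uniformly in \<open>x\<close>.\<close>
  have pt: "(\<phi> n x - u x)\<^sup>2 \<le> (b - a) * ?L (\<lambda>x. (w n x)\<^sup>2)" if x: "x \<in> {a..b}" for n x
  proof -
    let ?X = "\<lambda>h. LINT x:{a<..<x}|lborel. h x"
    have sub: "{a..x} \<subseteq> {a..b}" using x by auto
    note cw' = continuous_on_subset[OF cw sub]
    have "?X (w n) = (\<phi> n x - u x) - (\<phi> n a - u a)"
      using x sub unfolding w_def
      by (intro set_integral_Ioo_FTC cw'[unfolded w_def] derivative_intros DERIV_subset[OF \<phi>(2)]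
           DERIV_subset[OF u sub]) auto
    then have "(\<phi> n x - u x)\<^sup>2 = (?X (\<lambda>x. 1 * w n x))\<^sup>2"
      using test_function_facts(4)[OF \<phi>(1)] u0 by simp
    also have "\<dots> \<le> ?X (\<lambda>x. 1\<^sup>2) * ?X (\<lambda>x. (w n x)\<^sup>2)"
      by (intro L2_Cauchy_Schwarz L2_continuous cw' continuous_intros)
    also have "?X (\<lambda>x. 1\<^sup>2) = x - a"
      using x by (simp add: set_integral_Ioo_const)
    also have "?X (\<lambda>x. (w n x)\<^sup>2) = integral {a..x} (\<lambda>x. (w n x)\<^sup>2)"
      by (intro set_integral_Ioo_continuous continuous_intros cw')
    also have "\<dots> \<le> integral {a..b} (\<lambda>x. (w n x)\<^sup>2)"
      by (intro integral_subset_le sub integrable_continuous_real continuous_intros cw cw') auto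
    also have "\<dots> = ?L (\<lambda>x. (w n x)\<^sup>2)"
      by (intro set_integral_Ioo_continuous[symmetric] continuous_intros cw)
    finally have "(\<phi> n x - u x)\<^sup>2 \<le> (x - a) * ?L (\<lambda>x. (w n x)\<^sup>2)"
      using x by (auto simp: mult_left_mono)
    also have "\<dots> \<le> (b - a) * ?L (\<lambda>x. (w n x)\<^sup>2)"
      using x by (intro mult_right_mono) (auto simp: set_lebesgue_integral_def intro!: integral_nonneg_AE)
    finally show ?thesis .
  qed
  have le: "?L (\<lambda>x. (\<phi> n x - u x)\<^sup>2) \<le> (b - a)\<^sup>2 * ?L (\<lambda>x. (w n x)\<^sup>2)" for n
  proof -
    have "?L (\<lambda>x. (\<phi> n x - u x)\<^sup>2) \<le> ?L (\<lambda>x. (b - a) * ?L (\<lambda>x. (w n x)\<^sup>2))"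
      by (rule set_integral_mono)
         (auto intro!: set_integrable_Ioo_continuous continuous_intros cu pt test_function_facts(2)[OF \<phi>(1)])
    also have "\<dots> = (b - a)\<^sup>2 * ?L (\<lambda>x. (w n x)\<^sup>2)"
      using ab by (simp add: set_integral_Ioo_const power2_eq_square)
    finally show ?thesis .
  qed
  have "(\<lambda>n. (b - a)\<^sup>2 * ?L (\<lambda>x. (w n x)\<^sup>2)) \<longlonglongrightarrow> (b - a)\<^sup>2 * 0"
    by (intro tendsto_intros w0)
  then have lim: "(\<lambda>n. (b - a)\<^sup>2 * ?L (\<lambda>x. (w n x)\<^sup>2)) \<longlonglongrightarrow> 0" by simp
  have "(\<lambda>n. ?L (\<lambda>x. (\<phi> n x - u x)\<^sup>2)) \<longlonglongrightarrow> 0"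
    by (intro tendsto_sandwich[OF _ _ tendsto_const lim] always_eventually allI le)
       (auto simp: set_lebesgue_integral_def intro!: integral_nonneg_AE)
  then have "(\<lambda>n. ?L (\<lambda>x. (\<phi> n x - u x)\<^sup>2) + ?L (\<lambda>x. (deriv (\<phi> n) x - v x)\<^sup>2)) \<longlonglongrightarrow> 0"
    using tendsto_add[OF _ w0] by (force simp: d\<phi> w_def)
  then show ?thesis
    unfolding H10_def using weak_derivative_C1[OF _ v u] ab \<phi>(1) by fastforce
qed

section \<open>The first Dirichlet eigenvalue\<close>

lemma classical_imp_weak_dirichlet_solution:
  assumes ab: "a < b" and f: "continuous_on {a..b} f"
    and u: "\<And>x. x \<in> {a..b} \<Longrightarrow> (u has_real_derivative v x) (at x within {a..b})"
    and v: "\<And>x. x \<in> {a..b} \<Longrightarrow> (v has_real_derivative - f x) (at x within {a..b})"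
    and u0: "u a = 0" "u b = 0"
  shows "weak_dirichlet_solution a b f u"
proof -
  have cv: "continuous_on {a..b} v" using v by (rule DERIV_continuous_on)
  have "(LINT x:{a<..<b}|lborel. v x * deriv \<phi> x) = (LINT x:{a<..<b}|lborel. f x * \<phi> x)"
    if "\<phi> \<in> test_functions a b" for \<phi>
  proof -
    have "(LINT x:{a<..<b}|lborel. v x * deriv \<phi> x) = - (LINT x:{a<..<b}|lborel. - f x * \<phi> x)"
      by (intro test_function_integration_by_parts continuous_intros f that v) (use ab in auto)
    then show ?thesis by (simp add: set_lebesgue_integral_def)
  qed
  then show ?thesis
    unfolding weak_dirichlet_solution_def
    using C1_in_H10[OF ab cv u u0] weak_derivative_C1[OF less_imp_le[OF ab] cv u] by blast
qed

text \<open>Jacobi's trick: with \<open>w x = sin (\<pi> x / l)\<close> the integrand \<open>\<phi>'\<^sup>2 - (\<pi>/l)\<^sup>2 \<phi>\<^sup>2\<close> is the square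
  \<open>(\<phi>' - \<phi> w'/w)\<^sup>2\<close> plus the derivative of \<open>\<phi>\<^sup>2 w'/w\<close>.\<close>

lemma Wirtinger_test_functions:
  assumes l: "l > 0" and \<phi>: "\<phi> \<in> test_functions 0 l"
  shows "(pi / l)\<^sup>2 * (LINT x:{0<..<l}|lborel. (\<phi> x)\<^sup>2) \<le> (LINT x:{0<..<l}|lborel. (deriv \<phi> x)\<^sup>2)"
proof -
  note t = test_function_facts[OF \<phi>]
  obtain K where K: "compact K" "K \<subseteq> {0<..<l}" "\<And>x. x \<notin> K \<Longrightarrow> \<phi> x = 0"
    using \<phi> by (auto simp: test_functions_def)
  define w where "w = (\<lambda>x. sin (pi * x / l))"
  define w' where "w' = (\<lambda>x. pi / l * cos (pi * x / l))"
  define G where "G = (\<lambda>x. (\<phi> x)\<^sup>2 * w' x / w x)"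
  define h where "h = (\<lambda>x. (deriv \<phi> x)\<^sup>2 - (pi / l)\<^sup>2 * (\<phi> x)\<^sup>2)"
  have wpos: "w x > 0" if "x \<in> {0<..<l}" for x
    unfolding w_def using that l by (intro sin_gt_zero) (auto simp: field_simps)
  have dw: "(w has_real_derivative w' x) (at x)" "(w' has_real_derivative - (pi / l)\<^sup>2 * w x) (at x)" for x
    unfolding w_def w'_def using l by (auto intro!: derivative_eq_intros simp: power2_eq_square field_simps)
  have D: "\<exists>e. (G has_real_derivative e) (at x) \<and> e \<le> h x" for x
  proof (cases "x \<in> {0<..<l}")
    case True
    define e where "e = 2 * \<phi> x * deriv \<phi> x * w' x / w x - (pi / l)\<^sup>2 * (\<phi> x)\<^sup>2 - (\<phi> x)\<^sup>2 * (w' x)\<^sup>2 / (w x)\<^sup>2"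
    have "w x \<noteq> 0" using wpos[OF True] by simp
    then have "(G has_real_derivative e) (at x)"
      unfolding G_def e_def
      by (auto intro!: derivative_eq_intros t(1) dw simp: field_simps power2_eq_square)
    moreover have "h x - e = (deriv \<phi> x - \<phi> x * w' x / w x)\<^sup>2"
      using \<open>w x \<noteq> 0\<close> by (simp add: h_def e_def power2_eq_square field_simps)
    then have "e \<le> h x" by (metis diff_ge_0_iff_ge zero_le_power2)
    ultimately show ?thesis by blast
  next
    \<comment> \<open>\<open>w\<close> vanishes at 0 and \<open>l\<close>, but off \<open>K\<close>
      the numerator of \<open>G\<close> is 0 on an open set, so \<open>G\<close> is locally 0
      there.\<close>
    case False
    then have x: "x \<in> - K" using K by auto
    have o: "open (- K)" using K by (simp add: compact_imp_closed open_Compl)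
    have "((\<lambda>_. 0) has_real_derivative 0) (at x)" by simp
    then have G0: "(G has_real_derivative 0) (at x)"
      by (rule has_field_derivative_transform_within_open[OF _ o x]) (simp add: G_def K)
    moreover have "\<phi> x = 0" using x K by auto
    ultimately show ?thesis by (auto simp: h_def intro!: exI[of _ 0])
  qed
  have ch: "continuous_on {0..l} h"
    unfolding h_def by (intro continuous_intros t)
  obtain H where H: "\<And>x. x \<in> {0..l} \<Longrightarrow> (H has_real_derivative h x) (at x within {0..l})"
    using antiderivative_continuous[OF ch] by (auto simp: has_real_derivative_iff_has_vector_derivative)
  \<comment> \<open>\<open>H - G\<close> is nondecreasing because the derivative of \<open>G\<close>
    is at most \<open>h\<close>. As \<open>G\<close> vanishes at both ends, the integral of
    \<open>h\<close>, which is \<open>H l - H 0\<close>, is nonnegative.\<close>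
  have "(H l - G l) - (H 0 - G 0) \<ge> 0"
  proof -
    have "H 0 - G 0 \<le> H l - G l"
    proof (rule DERIV_nonneg_imp_increasing_open[of 0 l "\<lambda>x. H x - G x"])
      fix x assume x: "0 < x" "x < l"
      have "(H has_real_derivative h x) (at x)"
        using H[of x] x at_within_Icc_at[of 0 x l] by auto
      moreover obtain e where "(G has_real_derivative e) (at x)" "e \<le> h x" using D by blast
      ultimately show "\<exists>y. ((\<lambda>x. H x - G x) has_real_derivative y) (at x) \<and> 0 \<le> y"
        by (intro exI[of _ "h x - e"]) (auto intro!: derivative_intros)
    next
      have "continuous_on {0..l} G"
        using D by (meson DERIV_isCont continuous_at_imp_continuous_on)
      with DERIV_continuous_on[OF H] show "continuous_on {0..l} (\<lambda>x. H x - G x)"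
        by (rule continuous_on_diff)
    qed (use l in simp)
    then show ?thesis by simp
  qed
  moreover have "G 0 = 0" "G l = 0" using t by (auto simp: G_def)
  moreover have "(LINT x:{0<..<l}|lborel. h x) = H l - H 0"
    using l by (intro set_integral_Ioo_FTC ch H) auto
  moreover have "(LINT x:{0<..<l}|lborel. h x) = (LINT x:{0<..<l}|lborel. (deriv \<phi> x)\<^sup>2)
      - (pi / l)\<^sup>2 * (LINT x:{0<..<l}|lborel. (\<phi> x)\<^sup>2)"
    unfolding h_def
    by (subst set_integral_diff(2)) (auto intro!: set_integrable_Ioo_continuous continuous_intros t)
  ultimately show ?thesis by simp
qed

lemma nonzero_on_imp_L2_norm_pos:
  assumes "u \<in> L2 a b" "nonzero_on a b u"
  shows "(LINT x:{a<..<b}|lborel. (u x)\<^sup>2) > 0"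
proof -
  have i: "integrable lborel (\<lambda>x. indicator {a<..<b} x *\<^sub>R (u x)\<^sup>2)"
    using assms by (auto simp: L2_def set_integrable_def)
  have "(LINT x:{a<..<b}|lborel. (u x)\<^sup>2) \<noteq> 0"
  proof
    assume "(LINT x:{a<..<b}|lborel. (u x)\<^sup>2) = 0"
    then have "AE x in lborel. indicator {a<..<b} x *\<^sub>R (u x)\<^sup>2 = 0"
      using integral_nonneg_eq_0_iff_AE[OF i] by (auto simp: set_lebesgue_integral_def)
    then have "AE x in lborel. x \<in> {a<..<b} \<longrightarrow> u x = 0"
      by eventually_elim (auto simp: indicator_def)
    then show False using assms by (simp add: nonzero_on_def)
  qed
  moreover have "(LINT x:{a<..<b}|lborel. (u x)\<^sup>2) \<ge> 0"
    unfolding set_lebesgue_integral_def by (rule integral_nonneg_AE) auto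
  ultimately show ?thesis by simp
qed

text \<open>The weak derivative \<open>g\<close> given by membership in \<open>H10\<close> and the weak derivative \<open>g'\<close> of the weak
  equation are compared by testing with the derivatives of the approximating test functions.\<close>

lemma dirichlet_eigenvalue_lower_bound:
  assumes l: "l > 0" and ev: "dirichlet_eigenvalue 0 l c"
  shows "(pi / l)\<^sup>2 \<le> c"
proof -
  let ?L = "\<lambda>h. LINT x:{0<..<l}|lborel. h x"
  obtain u g' where u: "u \<in> H10 0 l" "nonzero_on 0 l u" "weak_derivative 0 l u g'"
    and eq: "\<And>\<phi>. \<phi> \<in> test_functions 0 l \<Longrightarrow> ?L (\<lambda>x. g' x * deriv \<phi> x) = ?L (\<lambda>x. c * u x * \<phi> x)"
    using ev by (auto simp: dirichlet_eigenvalue_def weak_dirichlet_solution_def)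
  obtain g \<phi> where g: "weak_derivative 0 l u g" and \<phi>: "\<And>n. \<phi> n \<in> test_functions 0 l"
    and lim: "(\<lambda>n. ?L (\<lambda>x. (\<phi> n x - u x)\<^sup>2) + ?L (\<lambda>x. (deriv (\<phi> n) x - g x)\<^sup>2)) \<longlonglongrightarrow> 0"
    using u(1) by (auto simp: H10_def)
  note t = test_function_facts[OF \<phi>]
  have L2: "u \<in> L2 0 l" "g \<in> L2 0 l" "g' \<in> L2 0 l" "\<And>n. \<phi> n \<in> L2 0 l" "\<And>n. deriv (\<phi> n) \<in> L2 0 l"
    using g u(3) t(6,7) by (auto simp: weak_derivative_def)
  have nn: "?L (\<lambda>x. (h x)\<^sup>2) \<ge> 0" for h :: "real \<Rightarrow> real"
    unfolding set_lebesgue_integral_def by (rule integral_nonneg_AE) auto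
  have lim1: "(\<lambda>n. ?L (\<lambda>x. (\<phi> n x - u x)\<^sup>2)) \<longlonglongrightarrow> 0"
    by (rule tendsto_sandwich[OF _ _ tendsto_const lim]) (simp_all add: nn)
  have lim2: "(\<lambda>n. ?L (\<lambda>x. (deriv (\<phi> n) x - g x)\<^sup>2)) \<longlonglongrightarrow> 0"
    by (rule tendsto_sandwich[OF _ _ tendsto_const lim]) (simp_all add: nn)
  have const: "(\<lambda>n::nat. ?L (\<lambda>x. (h x - h x)\<^sup>2)) \<longlonglongrightarrow> 0" for h :: "real \<Rightarrow> real"
    by simp
  \<comment> \<open>Testing the equation with \<open>\<phi> n\<close> and passing to the limit gives
    \<open>e1\<close>: the integral of g' g is c times that of u^2.\<close>
  have A: "(\<lambda>n. ?L (\<lambda>x. g' x * deriv (\<phi> n) x)) \<longlonglongrightarrow> ?L (\<lambda>x. g' x * g x)"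
    by (intro L2_tendsto_mult[OF _ _ const _ _ lim2] L2)
  have "(\<lambda>n. ?L (\<lambda>x. u x * \<phi> n x)) \<longlonglongrightarrow> ?L (\<lambda>x. u x * u x)"
    by (intro L2_tendsto_mult[OF _ _ const _ _ lim1] L2)
  then have "(\<lambda>n. c * ?L (\<lambda>x. u x * \<phi> n x)) \<longlonglongrightarrow> c * ?L (\<lambda>x. u x * u x)"
    by (intro tendsto_intros)
  moreover have "?L (\<lambda>x. g' x * deriv (\<phi> n) x) = c * ?L (\<lambda>x. u x * \<phi> n x)" for n
    by (simp add: eq[OF \<phi>] mult.assoc)
  ultimately have e1: "?L (\<lambda>x. g' x * g x) = c * ?L (\<lambda>x. u x * u x)"
    using A LIMSEQ_unique by simp
  have "?L (\<lambda>x. g x * \<psi> x) = ?L (\<lambda>x. g' x * \<psi> x)" if "\<psi> \<in> test_functions 0 l" for \<psi>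
    using g u(3) that by (force simp: weak_derivative_def)
  \<comment> \<open>\<open>\<phi> n\<close> is 0 on the open complement of \<open>K\<close>, hence
    so is its derivative, and the same \<open>K\<close> serves.\<close>
  moreover have "deriv (\<phi> n) \<in> test_functions 0 l" for n
  proof -
    obtain K where K: "compact K" "K \<subseteq> {0<..<l}" "\<And>x. x \<notin> K \<Longrightarrow> \<phi> n x = 0"
      using \<phi>[of n] by (auto simp: test_functions_def)
    have "deriv (\<phi> n) x = 0" if "x \<notin> K" for x
    proof -
      have "((\<lambda>_. 0) has_real_derivative 0) (at x)" by simp
      then have "(\<phi> n has_real_derivative 0) (at x)"
        by (rule has_field_derivative_transform_within_open[of _ _ _ "- K"])
           (use K that in \<open>auto simp: compact_imp_closed open_Compl\<close>)
      then show ?thesis by (rule DERIV_imp_deriv)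
    qed
    moreover have "(deriv ^^ k) (deriv (\<phi> n)) field_differentiable at x" for k x
      using \<phi>[of n] unfolding test_functions_def
      by (metis (mono_tags, lifting) comp_apply funpow_Suc_right mem_Collect_eq)
    ultimately show ?thesis
      using K unfolding test_functions_def by blast
  qed
  ultimately have "?L (\<lambda>x. g x * deriv (\<phi> n) x) = ?L (\<lambda>x. g' x * deriv (\<phi> n) x)" for n
    by blast
  moreover have "(\<lambda>n. ?L (\<lambda>x. g x * deriv (\<phi> n) x)) \<longlonglongrightarrow> ?L (\<lambda>x. g x * g x)"
    by (intro L2_tendsto_mult[OF _ _ const _ _ lim2] L2)
  ultimately have e2: "?L (\<lambda>x. g x * g x) = ?L (\<lambda>x. g' x * g x)"
    using A LIMSEQ_unique by simp
  \<comment> \<open>Final chain: (pi/l)^2 int u^2 <= int g^2 = int g' g = c int u^2, where the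
    inequality is Wirtinger's in the limit and the equalities are \<open>e2\<close> and
    \<open>e1\<close>.\<close>
  have "(\<lambda>n. (pi / l)\<^sup>2 * ?L (\<lambda>x. \<phi> n x * \<phi> n x)) \<longlonglongrightarrow> (pi / l)\<^sup>2 * ?L (\<lambda>x. u x * u x)"
    by (intro tendsto_mult tendsto_const L2_tendsto_mult[OF _ _ lim1 _ _ lim1] L2)
  moreover have "(\<lambda>n. ?L (\<lambda>x. deriv (\<phi> n) x * deriv (\<phi> n) x)) \<longlonglongrightarrow> ?L (\<lambda>x. g x * g x)"
    by (intro L2_tendsto_mult[OF _ _ lim2 _ _ lim2] L2)
  ultimately have "(pi / l)\<^sup>2 * ?L (\<lambda>x. u x * u x) \<le> ?L (\<lambda>x. g x * g x)"
    using Wirtinger_test_functions[OF l \<phi>] by (intro LIMSEQ_le) (auto simp: power2_eq_square)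
  then have "(pi / l)\<^sup>2 * ?L (\<lambda>x. (u x)\<^sup>2) \<le> c * ?L (\<lambda>x. (u x)\<^sup>2)"
    using e1 e2 by (simp add: power2_eq_square)
  then show ?thesis
    using nonzero_on_imp_L2_norm_pos[OF L2(1) u(2)] by simp
qed

lemma nonzero_on_continuous:
  assumes "continuous_on {a..b} u" "x \<in> {a<..<b}" "u x \<noteq> 0"
  shows "nonzero_on a b u"
  unfolding nonzero_on_def
proof
  assume ae: "AE x in lborel. x \<in> {a<..<b} \<longrightarrow> u x = 0"
  let ?S = "{a<..<b} \<inter> u -` (- {0})"
  have o: "open ?S"
    using assms(1) by (intro continuous_open_preimage) (auto intro: continuous_on_subset)
  moreover have "?S \<noteq> {}" using assms by auto
  ultimately have "\<not> negligible ?S" by (rule open_not_negligible)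
  moreover have "AE x in lborel. x \<notin> ?S"
    using ae by eventually_elim auto
  then have "AE x in lebesgue. x \<notin> ?S"
    by (rule AE_completion)
  then have "negligible ?S"
    using o by (simp add: negligible_iff_null_sets AE_iff_null_sets)
  ultimately show False by simp
qed

section \<open>Alternating sine arcs and the optimal partition\<close>

lemma has_real_derivative_glue:
  fixes g h :: "real \<Rightarrow> real"
  assumes "\<And>x. (g has_real_derivative g' x) (at x)" "\<And>x. (h has_real_derivative h' x) (at x)"
    and "g c = h c" "g' c = h' c"
  shows "((\<lambda>x. if x \<le> c then g x else h x) has_real_derivative (if x \<le> c then g' x else h' x)) (at x)"
proof -
  have "((\<lambda>x. if x \<in> {..c} then g x else h x) has_vector_derivative (if x \<in> {..c} then g' x else h' x))
          (at x within UNIV)"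
    by (rule has_vector_derivative_If_within_closures[where T="{c<..}"])
       (use assms in \<open>auto simp: has_real_derivative_iff_has_vector_derivative
          intro: has_vector_derivative_at_within\<close>)
  then show ?thesis by (simp add: has_real_derivative_iff_has_vector_derivative)
qed

text \<open>Total length of \<open>n\<close> consecutive half-waves with frequencies p, q, p, ...:
  one arch of sin(p x) occupies pi/p. The arguments are frequencies, the square roots of the
  spectral parameters.\<close>

definition fucik_length :: "real \<Rightarrow> real \<Rightarrow> nat \<Rightarrow> real" where
  "fucik_length p q n = (\<Sum>j<n. pi / (if even j then p else q))"

text \<open>Removing the first arc leaves a chain that begins with the other frequency; this is the
  exchange of \<open>p\<close> and \<open>q\<close> in the induction over arcs.\<close>

lemma fucik_length_Suc: "fucik_length p q (Suc n) = pi / p + fucik_length q p n"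
  unfolding fucik_length_def sum.lessThan_Suc_shift
  by (auto intro!: sum.cong)

lemma fucik_length_nonneg: "p > 0 \<Longrightarrow> q > 0 \<Longrightarrow> fucik_length p q n \<ge> 0"
  unfolding fucik_length_def by (intro sum_nonneg) auto

text \<open>The solution is built from the left, one sine arc at a time. The induction passes to the
  negative of the solution for the exchanged parameters, and the right-hand side \<open>f\<close> is required to
  exist on the whole line so that arcs can be glued on both sides of a zero.\<close>

lemma fucik_solution_exists:
  assumes "p > 0" "q > 0"
  shows "\<exists>u v f. (\<forall>x. (u has_real_derivative v x) (at x)) \<and> (\<forall>x. (v has_real_derivative - f x) (at x))
    \<and> u 0 = 0 \<and> v 0 = 1 \<and> f 0 = 0 \<and> u (fucik_length p q n) = 0
    \<and> (\<forall>x\<in>{0..fucik_length p q n}. f x = p\<^sup>2 * pos_part u x - q\<^sup>2 * neg_part u x)"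
  using assms
proof (induction n arbitrary: p q)
  case 0
  \<comment> \<open>The length is 0, so the equation is demanded at the point 0 only, where
    \<open>u\<close> and \<open>f\<close> vanish.\<close>
  show ?case
    by (rule exI[of _ "\<lambda>x. x"], rule exI[of _ "\<lambda>x. 1"], rule exI[of _ "\<lambda>x. 0"])
       (auto simp: fucik_length_def pos_part_def neg_part_def)
next
  case (Suc n)
  obtain u v f where d: "\<And>x. (u has_real_derivative v x) (at x)" "\<And>x. (v has_real_derivative - f x) (at x)"
    and z: "u 0 = 0" "v 0 = 1" "f 0 = 0" "u (fucik_length q p n) = 0"
    and f: "\<And>x. x \<in> {0..fucik_length q p n} \<Longrightarrow> f x = q\<^sup>2 * pos_part u x - p\<^sup>2 * neg_part u x"
    using Suc.IH[OF Suc.prems(2,1)] by blast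
  define c where "c = pi / p"
  have c: "c > 0" "p * c = pi" using Suc.prems by (auto simp: c_def)
  \<comment> \<open>The arc sin(p x)/p has slope 1 at 0 and slope cos(pi) = -1 at \<open>c\<close>,
    matching the negated solution normalised by \<open>v 0 = 1\<close>; \<open>f 0 = 0\<close>
    matches the second derivatives at \<open>c\<close>.\<close>
  define U where "U = (\<lambda>x. if x \<le> c then sin (p * x) / p else - u (x - c))"
  define V where "V = (\<lambda>x. if x \<le> c then cos (p * x) else - v (x - c))"
  define F where "F = (\<lambda>x. if x \<le> c then p * sin (p * x) else - f (x - c))"
  have shift: "((\<lambda>x. - u (x - c)) has_real_derivative - v (x - c)) (at x)"
      "((\<lambda>x. - v (x - c)) has_real_derivative - (- f (x - c))) (at x)" for x
    by (auto intro!: derivative_eq_intros DERIV_chain2[OF d(1)] DERIV_chain2[OF d(2)])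
  have "(U has_real_derivative V x) (at x)" for x
    unfolding U_def V_def
    by (rule has_real_derivative_glue[OF _ shift(1)])
       (use Suc.prems c z in \<open>auto intro!: derivative_eq_intros\<close>)
  moreover have "(V has_real_derivative - F x) (at x)" for x
  proof -
    have "(V has_real_derivative (if x \<le> c then - (p * sin (p * x)) else - (- f (x - c)))) (at x)"
      unfolding V_def
      by (rule has_real_derivative_glue[OF _ shift(2)])
         (use Suc.prems c z in \<open>auto intro!: derivative_eq_intros\<close>)
    then show ?thesis by (cases "x \<le> c") (simp_all add: F_def)
  qed
  moreover have "U 0 = 0" "V 0 = 1" "F 0 = 0" using c by (auto simp: U_def V_def F_def)
  moreover have L: "fucik_length p q (Suc n) = c + fucik_length q p n"
    by (simp add: fucik_length_Suc c_def)
  have "U (fucik_length p q (Suc n)) = 0"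
    unfolding L U_def using c z Suc.prems fucik_length_nonneg[of q p n] by auto
  moreover have "F x = p\<^sup>2 * pos_part U x - q\<^sup>2 * neg_part U x"
    if x: "x \<in> {0..fucik_length p q (Suc n)}" for x
  proof (cases "x \<le> c")
    case True
    have "p * x \<le> p * c" using True Suc.prems by (intro mult_left_mono) auto
    then have "sin (p * x) \<ge> 0"
      using x c Suc.prems by (intro sin_ge_zero) auto
    then show ?thesis
      using True Suc.prems by (simp add: F_def U_def pos_part_def neg_part_def power2_eq_square)
  next
    case False
    \<comment> \<open>Negation exchanges positive and negative parts, which undoes the exchange of
      \<open>p\<close> and \<open>q\<close>.\<close>
    then show ?thesis
      using x f[of "x - c"] unfolding L by (simp add: F_def U_def pos_part_def neg_part_def)
  qed
  ultimately show ?case by blast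
qed

lemma fucik_spectrum_memI:
  assumes "a < b" "p > 0" "q > 0" "fucik_length p q n = b - a"
  shows "(p\<^sup>2, q\<^sup>2) \<in> fucik_spectrum a b"
proof -
  obtain u v f where d: "\<And>x. (u has_real_derivative v x) (at x)" "\<And>x. (v has_real_derivative - f x) (at x)"
    and z: "u 0 = 0" "v 0 = 1" "u (b - a) = 0"
    and f: "\<And>x. x \<in> {0..b - a} \<Longrightarrow> f x = p\<^sup>2 * pos_part u x - q\<^sup>2 * neg_part u x"
    using fucik_solution_exists[OF assms(2,3), of n] unfolding assms(4) by blast
  define U where "U = (\<lambda>x. u (x - a))"
  have dU: "(U has_real_derivative v (x - a)) (at x)" for x
    using d(1)[of "x + - a"] unfolding U_def DERIV_shift by simp
  have cU: "continuous_on S U" for S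
    using dU by (meson DERIV_isCont continuous_at_imp_continuous_on)
  have dV: "((\<lambda>x. v (x - a)) has_real_derivative - (p\<^sup>2 * pos_part U x - q\<^sup>2 * neg_part U x)) (at x)"
    if "x \<in> {a..b}" for x
  proof -
    have "((\<lambda>x. v (x - a)) has_real_derivative - f (x - a)) (at x)"
      using d(2)[of "x + - a"] unfolding DERIV_shift by simp
    then show ?thesis using f[of "x - a"] that by (simp add: U_def pos_part_def neg_part_def)
  qed
  have "weak_dirichlet_solution a b (\<lambda>x. p\<^sup>2 * pos_part U x - q\<^sup>2 * neg_part U x) U"
  proof (rule classical_imp_weak_dirichlet_solution[where v="\<lambda>x. v (x - a)", OF assms(1)])
    show "continuous_on {a..b} (\<lambda>x. p\<^sup>2 * pos_part U x - q\<^sup>2 * neg_part U x)"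
      unfolding pos_part_def neg_part_def by (intro continuous_intros cU)
  qed (use z DERIV_subset[OF dU] DERIV_subset[OF dV] in \<open>auto simp: U_def\<close>)
  moreover have "nonzero_on a b U"
  proof -
    \<comment> \<open>The unit slope at 0 makes \<open>u\<close> positive just to the right of 0;
      \<open>h\<close> is then small enough for \<open>a + h\<close> to lie in the open
      interval.\<close>
    obtain e where e: "e > 0" "\<And>h. 0 < h \<Longrightarrow> h < e \<Longrightarrow> u 0 < u (0 + h)"
      using DERIV_pos_inc_right[OF d(1)[of 0]] z by auto
    define h where "h = min (e / 2) ((b - a) / 2)"
    have "0 < h" "h < e" "h < b - a" using e(1) assms(1) by (auto simp: h_def min_def)
    then show ?thesis
      using e(2)[of h] z by (intro nonzero_on_continuous[OF cU, of "a + h"]) (auto simp: U_def)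
  qed
  ultimately show ?thesis by (auto simp: fucik_spectrum_def)
qed

text \<open>This is the diagonal of the Fucik spectrum: for equal frequencies p^2 u^+ - p^2 u^- is
  p^2 u, and a single arc fills (0, l) when p = pi/l.\<close>

lemma dirichlet_eigenvalue_pi_div:
  assumes "l > 0"
  shows "dirichlet_eigenvalue 0 l ((pi / l)\<^sup>2)"
proof -
  have "fucik_length (pi / l) (pi / l) 1 = l - 0"
    using assms by (simp add: fucik_length_def)
  then have "((pi / l)\<^sup>2, (pi / l)\<^sup>2) \<in> fucik_spectrum 0 l"
    using assms by (intro fucik_spectrum_memI) auto
  moreover have "c * pos_part u x - c * neg_part u x = c * u x" for c u x
    by (simp add: pos_part_def neg_part_def max_def)
  ultimately show ?thesis
    by (auto simp: fucik_spectrum_def dirichlet_eigenvalue_def)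
qed

text \<open>A \<open>LEAST\<close> over the reals has its intended meaning once the minimum is
  attained; the half-wave sine attains the variational lower bound.\<close>

lemma first_eigenvalue_eq: "l > 0 \<Longrightarrow> first_eigenvalue l = (pi / l)\<^sup>2"
  unfolding first_eigenvalue_def
  by (intro Least_equality dirichlet_eigenvalue_pi_div dirichlet_eigenvalue_lower_bound)

section \<open>The energy of a partition and its minimum\<close>

lemma partition_energy_eq:
  "partition_energy r m t
    = Max ((\<lambda>j. (if even j then r else 1) * first_eigenvalue (t (Suc j) - t j)) ` {..<m})"
proof -
  have "{r * first_eigenvalue (t (2 * i + 1) - t (2 * i)) | i. 2 * i + 1 \<le> m} \<union>
        {first_eigenvalue (t (2 * i + 2) - t (2 * i + 1)) | i. 2 * i + 2 \<le> m}
      = (\<lambda>j. (if even j then r else 1) * first_eigenvalue (t (Suc j) - t j)) ` {..<m}" (is "?A = ?f ` _")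
  proof (intro equalityI subsetI)
    fix y assume "y \<in> ?A"
    \<comment> \<open>The families are the even and the odd intervals:
      \<open>2 * i + 1 \<le> m\<close> says \<open>2 * i < m\<close>, and
      \<open>2 * i + 2 \<le> m\<close> says \<open>2 * i + 1 < m\<close>.\<close>
    then consider i where "y = ?f (2 * i)" "2 * i < m" | i where "y = ?f (2 * i + 1)" "2 * i + 1 < m"
      by force
    then show "y \<in> ?f ` {..<m}" by cases blast+
  next
    fix y assume "y \<in> ?f ` {..<m}"
    then obtain j where j: "y = ?f j" "j < m" by auto
    show "y \<in> ?A"
    proof (cases "even j")
      case True
      then show ?thesis using j by (auto elim!: evenE)
    next
      case False
      then obtain i where "j = 2 * i + 1" by (auto elim: oddE)
      then show ?thesis using j by auto
    qed
  qed
  then show ?thesis by (simp add: partition_energy_def)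
qed

lemma partition_length_sum: "t \<in> partitions a b m \<Longrightarrow> (\<Sum>j<m. t (Suc j) - t j) = b - a"
  by (simp add: partitions_def sum_lessThan_telescope)

lemma optimal_energy_eq:
  assumes ab: "a < b" and m: "m > 0" and r: "r > 0"
  shows "optimal_energy a b m r = (fucik_length (1 / sqrt r) 1 m / (b - a))\<^sup>2"
proof -
  \<comment> \<open>Chosen so that the energy term of an interval of length l is (w j /
    l)^2.\<close>
  define w where "w = (\<lambda>j. pi * (if even (j::nat) then sqrt r else 1))"
  \<comment> \<open>The common square root of the terms when all are equal: the lengths w j / s must
    then add up to b - a.\<close>
  define s where "s = (\<Sum>j<m. w j) / (b - a)"
  have wpos: "w j > 0" for j using r by (simp add: w_def)
  then have "(\<Sum>j<m. w j) > 0" using m by (intro sum_pos) auto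
  then have s: "s > 0" using ab by (simp add: s_def)
  have w2: "(if even j then r else 1) * first_eigenvalue l = (w j / l)\<^sup>2" if "l > 0" for j l
    using that r by (simp add: first_eigenvalue_eq w_def power_divide power_mult_distrib)
  have lower: "s\<^sup>2 \<le> partition_energy r m t" if t: "t \<in> partitions a b m" for t
  proof (rule ccontr)
    assume "\<not> s\<^sup>2 \<le> partition_energy r m t"
    then have less: "partition_energy r m t < s\<^sup>2" by simp
    \<comment> \<open>With every term below s^2, each interval is longer than w j / s, and together
      they exceed b - a.\<close>
    have "w j < s * (t (Suc j) - t j)" if j: "j < m" for j
    proof -
      have pos: "t (Suc j) - t j > 0" using t j by (auto simp: partitions_def)
      have "(w j / (t (Suc j) - t j))\<^sup>2 \<le> partition_energy r m t"
        unfolding partition_energy_eq w2[OF pos, symmetric] using j by (intro Max_ge) auto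
      then have "(w j / (t (Suc j) - t j))\<^sup>2 < s\<^sup>2" using less by simp
      then have "w j / (t (Suc j) - t j) < s" using s by (simp add: power_less_imp_less_base)
      then show ?thesis using pos by (simp add: field_simps)
    qed
    then have "(\<Sum>j<m. w j) < (\<Sum>j<m. s * (t (Suc j) - t j))"
      using m by (intro sum_strict_mono) auto
    also have "\<dots> = s * (b - a)"
      by (simp add: sum_distrib_left[symmetric] partition_length_sum[OF t])
    also have "\<dots> = (\<Sum>j<m. w j)" using ab by (simp add: s_def)
    finally show False by simp
  qed
  define t where "t = (\<lambda>j. a + (\<Sum>i<j. w i) / s)"
  have inc: "t (Suc j) - t j = w j / s" for j by (simp add: t_def add_divide_distrib)
  have t: "t \<in> partitions a b m"
  proof -
    have "t j < t (Suc j)" for j using inc[of j] wpos[of j] s by (metis diff_gt_0_iff_gt divide_pos_pos)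
    moreover have "t m = b" using \<open>(\<Sum>j<m. w j) > 0\<close> ab by (simp add: t_def s_def)
    ultimately show ?thesis by (simp add: partitions_def t_def)
  qed
  have "partition_energy r m t = s\<^sup>2"
  proof -
    have "(if even j then r else 1) * first_eigenvalue (t (Suc j) - t j) = s\<^sup>2" for j
      using w2[of "w j / s" j] wpos[of j] s unfolding inc by simp
    then have "partition_energy r m t = Max ((\<lambda>j. s\<^sup>2) ` {..<m})"
      unfolding partition_energy_eq by simp
    then show ?thesis using m by (auto simp: image_constant_conv)
  qed
  then have "optimal_energy a b m r = s\<^sup>2"
    unfolding optimal_energy_def using t lower by (intro cInf_eq_minimum) force+
  \<comment> \<open>pi * sqrt r is the half-wave length for the frequency 1 / sqrt r.\<close>
  moreover have "(\<Sum>j<m. w j) = fucik_length (1 / sqrt r) 1 m"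
    unfolding fucik_length_def w_def by (intro sum.cong) auto
  ultimately show ?thesis by (simp add: s_def)
qed

theorem theorem1p3:
  fixes a b r :: real and k :: nat
  assumes "a < b" and "k \<ge> 1" and "r > 0"
  shows "(inverse r * optimal_energy a b (k + 1) r, optimal_energy a b (k + 1) r)
           \<in> fucik_spectrum a b"
proof -
  define L where "L = fucik_length (1 / sqrt r) 1 (k + 1)"
  define s where "s = L / (b - a)"
  have "L > 0"
    unfolding L_def fucik_length_def using assms(3) by (intro sum_pos) auto
  then have s: "s > 0" using assms(1) by (simp add: s_def)
  \<comment> \<open>Lengths scale inversely with frequencies: multiplying 1 / sqrt r and 1 by
    \<open>s\<close> divides the total length by \<open>s\<close>.\<close>
  have "fucik_length (s / sqrt r) s (k + 1) = L / s"
    unfolding L_def fucik_length_def sum_divide_distrib by (intro sum.cong) auto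
  also have "\<dots> = b - a" using \<open>L > 0\<close> by (simp add: s_def)
  finally have "((s / sqrt r)\<^sup>2, s\<^sup>2) \<in> fucik_spectrum a b"
    using assms s by (intro fucik_spectrum_memI) auto
  moreover have "optimal_energy a b (k + 1) r = s\<^sup>2"
    using optimal_energy_eq[OF assms(1) _ assms(3), of "k + 1"] by (simp add: s_def L_def)
  moreover have "(s / sqrt r)\<^sup>2 = inverse r * s\<^sup>2"
    using assms(3) by (simp add: power_divide inverse_eq_divide)
  ultimately show ?thesis by simp
qed

end
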